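(* Let $\mathcal{A}^{\mathbb{Z}}$ be an Abelian group shift, let $(\mathcal{A}^{\mathbb{Z}},F)$ be an algebraic bipermutative cellular automaton and let $\Sigma$ be a closed $(F,\sigma)$-invariant subgroup of $\mathcal{A}^{\mathbb{Z}}$. For $n\in\mathbb{N}$ put $D^\Sigma_n=\mathrm{Ker}(F^n)\cap\Sigma$, $\partial D^\Sigma_{n+1}=D^\Sigma_{n+1}\setminus D^\Sigma_n$, and $D^\Sigma_\infty=\bigcup_{n\in\mathbb{N}}D^\Sigma_n$. The following are equivalent: 1. $D^\Sigma_\infty$ contains no nontrivial $(F,\sigma)$-invariant infinite subgroup (i.e. every $(F,\sigma)$-invariant infinite subgroup of $D^\Sigma_\infty$ equals $D^\Sigma_\infty$). 2. There exist $m\in\mathbb{N}$ and $n_0\geq 1$ such that $D^\Sigma_{n_0}\subset\langle d\rangle_{F,\sigma}$ for all $d\in\partial D^\Sigma_{n_0+m}$. 3. There exists $m\in\mathbb{N}$ such that $D^\Sigma_{n_0}\subset\langle d\rangle_{F,\sigma}$ for all $n_0\in\mathbb{N}\setminus\{0\}$ and all $d\in\partial D^\Sigma_{n_0+m}$. 4. There exists $m\in\mathbb{N}$ such that $D^\Sigma_1\subset\langle d\rangle_{F,\sigma}$ for all $d\in\partial D^\Sigma_{m+1}$.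
   Context: $\mathcal{A}$ is a finite set, $\mathcal{A}^{\mathbb{Z}}$ has the product topology, $\sigma(x)_i=x_{i+1}$ is the shift, and $\mathbb{N}$ contains $0$. A cellular automaton (CA) is a continuous map $F:\mathcal{A}^{\mathbb{Z}}\to\mathcal{A}^{\mathbb{Z}}$ commuting with $\sigma$; equivalently there are a finite interval $\mathbb{U}\subset\mathbb{Z}$ and a local rule $\overline{F}:\mathcal{A}^{\mathbb{U}}\to\mathcal{A}$ with $F(x)_m=\overline{F}((x_{m+u})_{u\in\mathbb{U}})$; the smallest such interval is the smallest neighborhood. With smallest neighborhood $[r,s]$, $F$ is bipermutative if for all $u\in\mathcal{A}^{s-r}$, $b\in\mathcal{A}$ there is a unique $a\in\mathcal{A}$ with $\overline{F}(au)=b$ and a unique $a'\in\mathcal{A}$ with $\overline{F}(ua')=b$. $\mathcal{A}^{\mathbb{Z}}$ is an Abelian group shift if it carries an Abelian topological group structure (not necessarily a product structure) for which $\sigma$ is a continuous group endomorphism; a CA on it is algebraic if it is a group endomorphism. A subgroup $\Gamma$ is $(F,\sigma)$-invariant if $\sigma(\Gamma)=\Gamma$ and $F(\Gamma)\subset\Gamma$. $\langle d\rangle_{F,\sigma}$ is the smallest $(F,\sigma)$-invariant subgroup containing $d$, i.e. the subgroup generated by $\{\sigma^uF^{m}(d):u\in\mathbb{Z},m\in\mathbb{N}\}$. *)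

theory Defs
  imports "HOL-Analysis.Analysis" "HOL-Algebra.Coset"
begin

type_synonym 'a config = "int \<Rightarrow> 'a"

definition config_topology :: "'a config topology" where
  "config_topology = product_topology (\<lambda>_. discrete_topology UNIV) UNIV"

definition shift :: "'a config \<Rightarrow> 'a config" where
  "shift x = (\<lambda>i. x (i + 1))"

definition cellular_automaton :: "('a config \<Rightarrow> 'a config) \<Rightarrow> bool" where
  "cellular_automaton F \<longleftrightarrow>
     continuous_map config_topology config_topology F \<and> F \<circ> shift = shift \<circ> F"

text \<open>
  A local rule on the interval \<open>[r, s]\<close> is a function on words, of which only the values
  on words of length \<open>s - r + 1\<close> are relevant.
\<close>

definition local_rule ::
    "('a config \<Rightarrow> 'a config) \<Rightarrow> int \<Rightarrow> int \<Rightarrow> ('a list \<Rightarrow> 'a) \<Rightarrow> bool" where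
  "local_rule F r s f \<longleftrightarrow> r \<le> s \<and> (\<forall>x m. F x m = f (map (\<lambda>u. x (m + u)) [r..s]))"

text \<open>
  If \<open>F\<close> is not constant, any two neighborhoods of \<open>F\<close> meet and their intersection
  is again a neighborhood. The shortest neighborhood is then unique and contained in all others.
  Measuring by length keeps the notion meaningful for a one-letter alphabet, where every
  \<open>[r, r]\<close> is a shortest neighborhood.
\<close>

definition smallest_local_rule ::
    "('a config \<Rightarrow> 'a config) \<Rightarrow> int \<Rightarrow> int \<Rightarrow> ('a list \<Rightarrow> 'a) \<Rightarrow> bool" where
  "smallest_local_rule F r s f \<longleftrightarrow>
     local_rule F r s f \<and> (\<forall>r' s' f'. local_rule F r' s' f' \<longrightarrow> s - r \<le> s' - r')"

definition bipermutative :: "('a config \<Rightarrow> 'a config) \<Rightarrow> bool" where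
  "bipermutative F \<longleftrightarrow>
     (\<exists>r s f. smallest_local_rule F r s f \<and>
        (\<forall>u b. length u = nat (s - r) \<longrightarrow>
           (\<exists>!a. f (a # u) = b) \<and> (\<exists>!a'. f (u @ [a']) = b)))"

definition abelian_group_shift :: "'a config monoid \<Rightarrow> bool" where
  "abelian_group_shift G \<longleftrightarrow>
     comm_group G \<and> carrier G = UNIV \<and>
     continuous_map (prod_topology config_topology config_topology) config_topology
       (\<lambda>(x, y). x \<otimes>\<^bsub>G\<^esub> y) \<and>
     continuous_map config_topology config_topology (\<lambda>x. inv\<^bsub>G\<^esub> x) \<and>
     continuous_map config_topology config_topology (shift :: 'a config \<Rightarrow> 'a config) \<and>
     shift \<in> hom G G"

definition algebraic_CA :: "'a config monoid \<Rightarrow> ('a config \<Rightarrow> 'a config) \<Rightarrow> bool" where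
  "algebraic_CA G F \<longleftrightarrow> cellular_automaton F \<and> F \<in> hom G G"

definition invariant_subgroup ::
    "'a config monoid \<Rightarrow> ('a config \<Rightarrow> 'a config) \<Rightarrow> 'a config set \<Rightarrow> bool" where
  "invariant_subgroup G F \<Gamma> \<longleftrightarrow> subgroup \<Gamma> G \<and> shift ` \<Gamma> = \<Gamma> \<and> F ` \<Gamma> \<subseteq> \<Gamma>"

definition invariant_span ::
    "'a config monoid \<Rightarrow> ('a config \<Rightarrow> 'a config) \<Rightarrow> 'a config \<Rightarrow> 'a config set" where
  "invariant_span G F d = \<Inter>{\<Gamma>. invariant_subgroup G F \<Gamma> \<and> d \<in> \<Gamma>}"

definition D ::
    "'a config monoid \<Rightarrow> ('a config \<Rightarrow> 'a config) \<Rightarrow> 'a config set \<Rightarrow> nat \<Rightarrow> 'a config set" where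
  "D G F \<Sigma> n = kernel G G (F ^^ n) \<inter> \<Sigma>"

text \<open>Only meant for \<open>n \<ge> 1\<close>.\<close>

definition boundary_D ::
    "'a config monoid \<Rightarrow> ('a config \<Rightarrow> 'a config) \<Rightarrow> 'a config set \<Rightarrow> nat \<Rightarrow> 'a config set" where
  "boundary_D G F \<Sigma> n = D G F \<Sigma> n - D G F \<Sigma> (n - 1)"

definition D_infinity ::
    "'a config monoid \<Rightarrow> ('a config \<Rightarrow> 'a config) \<Rightarrow> 'a config set \<Rightarrow> 'a config set" where
  "D_infinity G F \<Sigma> = (\<Union>n. D G F \<Sigma> n)"

end

(*
  By bipermutativity a point is determined by its image under F and finitely many of its
  coordinates, so each D_n is finite. Given 4, apply it to F^{n_0-1}(d) and climb from D_k to
  D_{k+1} for k < n_0 to obtain 3. Given 3, an infinite invariant subgroup of D_infinity leaves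
  every D_n, hence contains all of them. If 4 fails, the sets of d in the n-th boundary with
  D_1 not contained in <d> form an inverse system of finite nonempty sets under F; a point
  (d_n) of its limit gives an increasing union of the <d_n>, which is an infinite invariant
  subgroup that misses part of the finite set D_1, against 1.
*)
theory Submission
  imports Defs
begin

section \<open>Threads through inverse systems of finite sets\<close>

text \<open>A Koenig-type argument: only points that have preimages at every depth are kept.
  Finiteness provides such a point at level 0, and above each such point another one, so dependent
  choice yields the thread. One self-map \<open>f\<close> serves as all bonding maps, as it will be
  the automaton itself.\<close>

lemma inverse_limit_nonempty:
  fixes f :: "'b \<Rightarrow> 'b" and E :: "nat \<Rightarrow> 'b set"
  assumes fin: "\<And>n. finite (E n)" and ne: "\<And>n. E n \<noteq> {}"
    and step: "\<And>n x. x \<in> E (Suc n) \<Longrightarrow> f x \<in> E n"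
  obtains d where "\<And>n. d n \<in> E n" "\<And>n. f (d (Suc n)) = d n"
proof -
  have pow: "(f ^^ k) x \<in> E n" if "x \<in> E (n + k)" for n k x
    using that
  proof (induction k arbitrary: x)
    case (Suc k)
    then show ?case using step[of x "n + k"] by (simp add: funpow_swap1)
  qed simp
  define good where "good n x \<longleftrightarrow> x \<in> E n \<and> (\<forall>k. \<exists>y\<in>E (n + k). (f ^^ k) y = x)" for n x
  \<comment> \<open>The set \<open>A\<close> lets one pigeonhole argument serve twice: with
    \<open>UNIV\<close> it starts the thread, with a fibre of \<open>f\<close> it prolongs
    it.\<close>
  have ex_good: "\<exists>z. good n z \<and> z \<in> A"
    if A: "\<And>k. \<exists>y\<in>E (n + k). (f ^^ k) y \<in> A" for n A
  proof -
    obtain y where y: "\<And>k. y k \<in> E (n + k)" "\<And>k. (f ^^ k) (y k) \<in> A"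
      using A by metis
    let ?z = "\<lambda>k. (f ^^ k) (y k)"
    have "range ?z \<subseteq> E n" using y pow by blast
    then have "finite (range ?z)" using fin finite_subset by blast
    then obtain k0 where inf: "infinite {k. ?z k = ?z k0}"
      using pigeonhole_infinite[of "UNIV :: nat set" ?z] by auto
    have "\<exists>w\<in>E (n + k). (f ^^ k) w = ?z k0" for k
    proof -
      \<comment> \<open>The value recurs at infinitely many depths, hence at some depth
        \<open>l\<close> beyond \<open>k\<close>; moving \<open>y l\<close> down by
        \<open>l - k\<close> levels gives a witness at depth \<open>k\<close>.\<close>
      obtain l where l: "l \<ge> k" "?z l = ?z k0"
        using inf by (metis (mono_tags, lifting) infinite_nat_iff_unbounded_le mem_Collect_eq)
      have "(f ^^ (l - k)) (y l) \<in> E (n + k)"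
        using pow[of "y l" "n + k" "l - k"] y(1)[of l] l(1) by simp
      moreover have "(f ^^ k) ((f ^^ (l - k)) (y l)) = ?z k0"
        using l by (metis funpow_add le_add_diff_inverse comp_apply)
      ultimately show ?thesis by blast
    qed
    then show ?thesis using y(2)[of k0] pow[OF y(1)] unfolding good_def by blast
  qed
  have "\<exists>z. good 0 z"
    using ex_good[of 0 UNIV] ne by fastforce
  moreover have "\<exists>z. good (Suc n) z \<and> f z = x" if good: "good n x" for n x
  proof -
    have "\<exists>y\<in>E (Suc n + k). (f ^^ k) y \<in> {z. f z = x}" for k
    proof -
      \<comment> \<open>A witness at depth \<open>Suc k\<close> above level \<open>n\<close> is a
        witness at depth \<open>k\<close> above level \<open>Suc n\<close> that lands in the fibre
        over \<open>x\<close>.\<close>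
      obtain y where "y \<in> E (n + Suc k)" "(f ^^ Suc k) y = x"
        using good unfolding good_def by blast
      then show ?thesis by auto
    qed
    then show ?thesis using ex_good[of "Suc n" "{z. f z = x}"] by blast
  qed
  ultimately obtain d where "\<And>n. good n (d n)" "\<And>n. f (d (Suc n)) = d n"
    using dependent_nat_choice[of good "\<lambda>_ x y. f y = x"] by metis
  then show thesis using that unfolding good_def by blast
qed

section \<open>Finite fibres of bipermutative automata\<close>

lemma bij_shift: "bij (shift :: 'a config \<Rightarrow> 'a config)"
proof (rule bijI)
  show "inj (shift :: 'a config \<Rightarrow> 'a config)"
  proof (rule injI)
    fix x y :: "'a config" assume eq: "shift x = shift y"
    have "x i = y i" for i
      using fun_cong[OF eq, of "i - 1"] by (simp add: shift_def)
    then show "x = y" by blast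
  qed
  have "y = shift (\<lambda>i. y (i - 1))" for y :: "'a config"
    by (simp add: shift_def)
  then show "surj (shift :: 'a config \<Rightarrow> 'a config)" by blast
qed

lemma map_upto_left: "(r::int) \<le> s \<Longrightarrow> map g [r..s] = g r # map g [r+1..s]"
  by (simp add: upto_rec1)

lemma map_upto_right: "(r::int) \<le> s \<Longrightarrow> map g [r..s] = map g [r..s-1] @ [g s]"
  by (simp add: upto_rec2)

text \<open>Once all cells of a neighborhood but an extreme one are known, the image determines that
  cell by permutativity. Agreement on \<open>s - r\<close> consecutive cells therefore spreads one
  cell to the right and one to the left at a time.\<close>

lemma bipermutative_eqI:
  fixes F :: "('a config \<Rightarrow> 'a config)"
  assumes rule: "local_rule F r s f"
    and perm: "\<And>u b. length u = nat (s - r) \<Longrightarrow>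
           (\<exists>!a. f (a # u) = b) \<and> (\<exists>!a'. f (u @ [a']) = b)"
    and F: "F x = F y" and agree: "\<And>i. 0 \<le> i \<Longrightarrow> i < s - r \<Longrightarrow> x i = y i"
  shows "x = y"
proof -
  have rs: "r \<le> s" and loc: "\<And>x m. F x m = f (map (\<lambda>u. x (m + u)) [r..s])"
    using rule by (auto simp: local_rule_def)
  have right: "x (m + s) = y (m + s)" if "\<And>i. m + r \<le> i \<Longrightarrow> i < m + s \<Longrightarrow> x i = y i" for m
  proof -
    let ?u = "map (\<lambda>u. x (m + u)) [r..s-1]"
    have u: "?u = map (\<lambda>u. y (m + u)) [r..s-1]" using that by simp
    have "f (?u @ [x (m + s)]) = f (?u @ [y (m + s)])"
      using fun_cong[OF F, of m] unfolding loc map_upto_right[OF rs] u .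
    moreover have "length ?u = nat (s - r)" by simp
    ultimately show ?thesis using perm by metis
  qed
  have left: "x (m + r) = y (m + r)" if "\<And>i. m + r < i \<Longrightarrow> i \<le> m + s \<Longrightarrow> x i = y i" for m
  proof -
    let ?u = "map (\<lambda>u. x (m + u)) [r+1..s]"
    have u: "?u = map (\<lambda>u. y (m + u)) [r+1..s]" using that by simp
    have "f (x (m + r) # ?u) = f (y (m + r) # ?u)"
      using fun_cong[OF F, of m] unfolding loc map_upto_left[OF rs] u .
    moreover have "length ?u = nat (s - r)" by simp
    ultimately show ?thesis using perm by metis
  qed
  have grow: "\<forall>i. - int n \<le> i \<and> i < s - r + int n \<longrightarrow> x i = y i" for n
  proof (induction n)
    case 0
    then show ?case using agree by simp
  next
    case (Suc n)
    \<comment> \<open>The offset \<open>int n - r\<close> places the neighborhood on the cells from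
      \<open>int n\<close> to \<open>s - r + int n\<close>, of which only the last is new. The
      offset for \<open>left\<close> likewise makes \<open>- 1 - int n\<close> the first
      cell.\<close>
    have "x (s - r + int n) = y (s - r + int n)"
      using right[of "int n - r"] Suc by (simp add: algebra_simps)
    moreover have "x (- 1 - int n) = y (- 1 - int n)"
      using left[of "- 1 - int n - r"] Suc by (simp add: algebra_simps)
    moreover have "(- int n \<le> i \<and> i < s - r + int n) \<or> i = s - r + int n \<or> i = - 1 - int n"
      if "- int (Suc n) \<le> i" "i < s - r + int (Suc n)" for i
      using that by auto
    ultimately show ?case using Suc by blast
  qed
  have "x i = y i" for i
  proof -
    have "- int (Suc (nat \<bar>i\<bar>)) \<le> i \<and> i < s - r + int (Suc (nat \<bar>i\<bar>))" using rs by auto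
    then show ?thesis using grow by blast
  qed
  then show ?thesis by blast
qed

text \<open>Points of one fibre are separated by their words on a window of \<open>s - r\<close>
  cells, and there are finitely many such words.\<close>

lemma bipermutative_finite_fibre:
  fixes F :: "('a :: finite) config \<Rightarrow> 'a config"
  assumes "bipermutative F"
  shows "finite {x. F x = y}"
proof -
  from assms obtain r s f where rule: "local_rule F r s f"
    and perm: "\<And>u b. length u = nat (s - r) \<Longrightarrow>
           (\<exists>!a. f (a # u) = b) \<and> (\<exists>!a'. f (u @ [a']) = b)"
    by (auto simp: bipermutative_def smallest_local_rule_def)
  let ?I = "{0..<s - r}"
  have "inj_on (\<lambda>x. restrict x ?I) {x. F x = y}"
  proof (rule inj_onI)
    fix x x' assume "x \<in> {x. F x = y}" "x' \<in> {x. F x = y}" and eq: "restrict x ?I = restrict x' ?I"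
    moreover have "x i = x' i" if "0 \<le> i" "i < s - r" for i
      using fun_cong[OF eq, of i] that by simp
    ultimately show "x = x'"
      using bipermutative_eqI[OF rule perm, of x x'] by auto
  qed
  moreover have "(\<lambda>x. restrict x ?I) ` {x. F x = y} \<subseteq> PiE ?I (\<lambda>_. UNIV)"
    by auto
  moreover have "finite (PiE ?I (\<lambda>_. UNIV :: 'a set))"
    by (intro finite_PiE) auto
  ultimately show ?thesis
    using finite_imageD finite_subset by blast
qed

section \<open>The subgroups \<open>D\<close> and the invariant spans\<close>

text \<open>The algebraic setting of the proof. Bipermutativity enters through its consequence
  \<open>finite_fibre\<close>, which makes every \<open>D G F \<Sigma> n\<close> finite.\<close>

locale algebraic_ca = group G for G :: "(int \<Rightarrow> 'a) monoid" (structure) +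
  fixes F :: "(int \<Rightarrow> 'a) \<Rightarrow> (int \<Rightarrow> 'a)" and \<Sigma> :: "(int \<Rightarrow> 'a) set"
  assumes carrier [simp]: "carrier G = UNIV"
    and F_hom: "F \<in> hom G G" and shift_hom: "shift \<in> hom G G"
    and commute: "F (shift x) = shift (F x)"
    and \<Sigma>_inv: "invariant_subgroup G F \<Sigma>"
    and finite_fibre: "finite {x. F x = y}"
begin

lemma pow_hom: "F ^^ n \<in> hom G G"
proof (induction n)
  case (Suc n)
  then show ?case using F_hom by (auto simp: hom_def)
qed (simp add: hom_def)

lemma group_hom_pow: "group_hom G G (F ^^ n)"
  using pow_hom by unfold_locales

lemma group_hom_shift: "group_hom G G shift"
  using shift_hom by unfold_locales

lemma pow_one [simp]: "(F ^^ n) \<one> = \<one>"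
  by (rule group_hom.hom_one[OF group_hom_pow])

lemma pow_mult: "(F ^^ n) (x \<otimes> y) = (F ^^ n) x \<otimes> (F ^^ n) y"
  using pow_hom by (simp add: hom_def)

lemma pow_inv: "(F ^^ n) (inv x) = inv ((F ^^ n) x)"
  using group_hom.hom_inv[OF group_hom_pow] by simp

lemma pow_shift: "(F ^^ n) (shift x) = shift ((F ^^ n) x)"
  by (induction n) (simp_all add: commute)

lemma mem_D: "x \<in> D G F \<Sigma> n \<longleftrightarrow> (F ^^ n) x = \<one> \<and> x \<in> \<Sigma>"
  by (simp add: D_def kernel_def)

lemma F_\<Sigma>: "x \<in> \<Sigma> \<Longrightarrow> F x \<in> \<Sigma>"
  using \<Sigma>_inv by (auto simp: invariant_subgroup_def)

lemma D_Suc_iff: "x \<in> D G F \<Sigma> (Suc n) \<longleftrightarrow> x \<in> \<Sigma> \<and> F x \<in> D G F \<Sigma> n"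
  by (auto simp: mem_D F_\<Sigma> funpow_swap1)

lemma D_mono: "m \<le> n \<Longrightarrow> D G F \<Sigma> m \<subseteq> D G F \<Sigma> n"
proof (rule lift_Suc_mono_le[of "D G F \<Sigma>"])
  show "D G F \<Sigma> n \<subseteq> D G F \<Sigma> (Suc n)" for n
    using group_hom.hom_one[OF group_hom_pow[of 1]] by (auto simp: mem_D)
qed

lemma finite_D: "finite (D G F \<Sigma> n)"
proof (induction n)
  case 0
  then show ?case by (rule finite_subset[of _ "{\<one>}"]) (auto simp: mem_D)
next
  case (Suc n)
  have "D G F \<Sigma> (Suc n) \<subseteq> (\<Union>y\<in>D G F \<Sigma> n. {x. F x = y})"
    by (auto simp: D_Suc_iff)
  then show ?case
    using Suc finite_fibre by (meson finite_UN_I finite_subset)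
qed

lemma shift_one [simp]: "shift \<one> = \<one>"
  by (rule group_hom.hom_one[OF group_hom_shift])

lemma invariant_D: "invariant_subgroup G F (D G F \<Sigma> n)"
proof -
  have sub: "subgroup \<Sigma> G" and sh: "shift ` \<Sigma> = \<Sigma>"
    using \<Sigma>_inv by (auto simp: invariant_subgroup_def)
  have "subgroup (D G F \<Sigma> n) G"
    unfolding D_def
    by (intro subgroups_Inter_pair group_hom.subgroup_kernel group_hom_pow sub)
  \<comment> \<open>Invariance asks for equality under the shift, not mere inclusion, hence the
    equivalence; its backward direction rests on injectivity of the shift.\<close>
  moreover have "shift x \<in> D G F \<Sigma> n \<longleftrightarrow> x \<in> D G F \<Sigma> n" for x
  proof -
    have "shift y = \<one> \<longleftrightarrow> y = \<one>" for y
      using bij_is_inj[OF bij_shift] shift_one by (metis injD)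
    moreover have "shift x \<in> \<Sigma> \<longleftrightarrow> x \<in> \<Sigma>"
      using sh inj_image_mem_iff[OF bij_is_inj[OF bij_shift]] by blast
    ultimately show ?thesis by (simp add: mem_D pow_shift)
  qed
  then have "shift ` D G F \<Sigma> n = D G F \<Sigma> n"
    using surj_image_vimage_eq[OF bij_is_surj[OF bij_shift]] by (metis vimage_eq subsetI subset_antisym)
  moreover have "F ` D G F \<Sigma> n \<subseteq> D G F \<Sigma> n"
    using D_mono[of n "Suc n"] D_Suc_iff by auto
  ultimately show ?thesis by (simp add: invariant_subgroup_def)
qed

lemma invariant_UNIV: "invariant_subgroup G F UNIV"
  using subgroup_self bij_is_surj[OF bij_shift] by (simp add: invariant_subgroup_def)

lemma invariant_span_invariant: "invariant_subgroup G F (invariant_span G F d)"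
proof -
  let ?A = "{\<Gamma>. invariant_subgroup G F \<Gamma> \<and> d \<in> \<Gamma>}"
  have ne: "?A \<noteq> {}" using invariant_UNIV by blast
  have "subgroup (\<Inter>?A) G"
    using ne by (intro subgroups_Inter) (auto simp: invariant_subgroup_def)
  moreover have "shift ` \<Inter>?A = \<Inter>?A"
  proof -
    \<comment> \<open>Bijectivity of the shift lets the image commute with the intersection.\<close>
    have "shift ` \<Inter>?A = (\<Inter>\<Gamma>\<in>?A. shift ` \<Gamma>)"
      using ne by (intro bij_image_INT[OF bij_shift, of "\<lambda>\<Gamma>. \<Gamma>", simplified])
    also have "\<dots> = \<Inter>?A" by (auto simp: invariant_subgroup_def)
    finally show ?thesis .
  qed
  moreover have "F ` \<Inter>?A \<subseteq> \<Inter>?A" by (auto simp: invariant_subgroup_def)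
  ultimately show ?thesis by (simp add: invariant_subgroup_def invariant_span_def)
qed

lemma mem_invariant_span: "d \<in> invariant_span G F d"
  by (simp add: invariant_span_def)

lemma invariant_span_least:
  "invariant_subgroup G F \<Gamma> \<Longrightarrow> d \<in> \<Gamma> \<Longrightarrow> invariant_span G F d \<subseteq> \<Gamma>"
  by (auto simp: invariant_span_def)

section \<open>Powers of \<open>F\<close> on spans and boundaries\<close>

lemma invariant_pow:
  "invariant_subgroup G F \<Gamma> \<Longrightarrow> x \<in> \<Gamma> \<Longrightarrow> (F ^^ n) x \<in> \<Gamma>"
  by (induction n) (auto simp: invariant_subgroup_def)

lemma invariant_pow_image:
  assumes "invariant_subgroup G F \<Gamma>"
  shows "invariant_subgroup G F ((F ^^ n) ` \<Gamma>)"
proof -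
  have "subgroup ((F ^^ n) ` \<Gamma>) G"
    using assms group_hom.subgroup_img_is_subgroup[OF group_hom_pow]
    by (simp add: invariant_subgroup_def)
  moreover have "shift ` (F ^^ n) ` \<Gamma> = (F ^^ n) ` shift ` \<Gamma>"
    by (simp add: image_image pow_shift)
  moreover have "F ` (F ^^ n) ` \<Gamma> = (F ^^ n) ` F ` \<Gamma>"
    by (simp add: image_image funpow_swap1)
  ultimately show ?thesis
    using assms by (auto simp: invariant_subgroup_def)
qed

text \<open>The right-hand side is an invariant subgroup containing \<open>(F ^^ n) d\<close>. This
  allows elements of the smaller span to be pulled back along \<open>F ^^ n\<close> to the span of
  \<open>d\<close>.\<close>

lemma invariant_span_pow_subset:
  "invariant_span G F ((F ^^ n) d) \<subseteq> (F ^^ n) ` invariant_span G F d"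
  by (intro invariant_span_least invariant_pow_image invariant_span_invariant imageI
      mem_invariant_span)

text \<open>Applying \<open>F ^^ k\<close> lowers by exactly \<open>k\<close> the least power of
  \<open>F\<close> that kills \<open>d\<close>. The index is a successor so that the truncated
  \<open>n - 1\<close> in \<open>boundary_D\<close> is a true predecessor.\<close>

lemma boundary_pow:
  assumes "d \<in> boundary_D G F \<Sigma> (Suc n + k)"
  shows "(F ^^ k) d \<in> boundary_D G F \<Sigma> (Suc n)"
  using assms invariant_pow[OF \<Sigma>_inv]
  by (auto simp: boundary_D_def mem_D funpow_add)

text \<open>This carries 4 to 3 with the same \<open>m\<close>. By induction on \<open>k\<close>, an
  element of level \<open>Suc k\<close> is corrected by an element of the span until
  \<open>F ^^ k\<close> kills the difference, which then lies in the span by the induction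
  hypothesis.\<close>

lemma D_subset_span_lift:
  assumes m: "\<And>d. d \<in> boundary_D G F \<Sigma> (Suc m) \<Longrightarrow> D G F \<Sigma> 1 \<subseteq> invariant_span G F d"
    and d: "d \<in> boundary_D G F \<Sigma> (Suc n + m)"
  shows "D G F \<Sigma> (Suc n) \<subseteq> invariant_span G F d"
proof -
  let ?S = "invariant_span G F d"
  have sub: "subgroup ?S G"
    using invariant_span_invariant by (simp add: invariant_subgroup_def)
  have \<Sigma>: "subgroup \<Sigma> G" using \<Sigma>_inv by (simp add: invariant_subgroup_def)
  have dD: "d \<in> D G F \<Sigma> (Suc n + m)" using d by (simp add: boundary_D_def)
  \<comment> \<open>This keeps the corrected element \<open>x \<otimes> inv ?z\<close> below inside
    \<open>\<Sigma>\<close>.\<close>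
  have S\<Sigma>: "?S \<subseteq> \<Sigma>"
    using invariant_span_least[OF invariant_D dD] by (auto simp: mem_D)
  have "(F ^^ n) d \<in> boundary_D G F \<Sigma> (Suc m)"
    using d boundary_pow[of d m n] by (simp add: add.commute)
  then have base: "D G F \<Sigma> 1 \<subseteq> (F ^^ n) ` ?S"
    using m invariant_span_pow_subset by blast
  have "k \<le> Suc n \<Longrightarrow> D G F \<Sigma> k \<subseteq> ?S" for k
  proof (induction k)
    case 0
    then show ?case using subgroup.one_closed[OF sub] by (auto simp: mem_D)
  next
    case (Suc k)
    show ?case
    proof
      fix x assume x: "x \<in> D G F \<Sigma> (Suc k)"
      have "(F ^^ k) x \<in> D G F \<Sigma> 1"
        using x by (auto simp: mem_D invariant_pow[OF \<Sigma>_inv])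
      then obtain y where y: "y \<in> ?S" "(F ^^ k) x = (F ^^ n) y" using base by blast
      \<comment> \<open>Since \<open>k \<le> n\<close>, the equation
        \<open>(F ^^ k) x = (F ^^ n) y\<close> factors through \<open>F ^^ k\<close>; the exponent
        \<open>n - k\<close> makes \<open>?z\<close> and \<open>x\<close> have the same image under
        \<open>F ^^ k\<close>.\<close>
      let ?z = "(F ^^ (n - k)) y"
      have z: "?z \<in> ?S" using y invariant_pow[OF invariant_span_invariant] by blast
      have "(F ^^ k) ?z = (F ^^ k) x"
        using y Suc.prems by (metis Suc_le_mono funpow_add le_add_diff_inverse comp_apply)
      then have "(F ^^ k) (x \<otimes> inv ?z) = \<one>" by (simp add: pow_mult pow_inv)
      moreover have "x \<otimes> inv ?z \<in> \<Sigma>"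
        using x z S\<Sigma> \<Sigma> by (auto simp: mem_D subgroup_def)
      ultimately have "x \<otimes> inv ?z \<in> ?S" using Suc by (auto simp: mem_D)
      then have "(x \<otimes> inv ?z) \<otimes> ?z \<in> ?S" using z sub by (simp add: subgroup_def)
      then show "x \<in> ?S" by (simp add: m_assoc)
    qed
  qed
  then show ?thesis by simp
qed

section \<open>Infinite invariant subgroups of \<open>D_infinity\<close>\<close>

text \<open>An infinite \<open>\<Gamma>\<close> does not fit into the finite
  \<open>D G F \<Sigma> n\<close>. An element outside it has an exact level \<open>k > n\<close>,
  and \<open>F\<close> lowers this level to \<open>Suc n\<close> without leaving
  \<open>\<Gamma>\<close>.\<close>

lemma infinite_invariant_meets_boundary:
  assumes \<Gamma>: "invariant_subgroup G F \<Gamma>" "infinite \<Gamma>" "\<Gamma> \<subseteq> D_infinity G F \<Sigma>"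
  shows "\<exists>d\<in>\<Gamma>. d \<in> boundary_D G F \<Sigma> (Suc n)"
proof -
  obtain x where x: "x \<in> \<Gamma>" "x \<notin> D G F \<Sigma> n"
    using \<Gamma>(2) by (meson finite_D finite_subset subsetI)
  define k where "k = (LEAST k. x \<in> D G F \<Sigma> k)"
  have "\<exists>k. x \<in> D G F \<Sigma> k" using x \<Gamma>(3) by (auto simp: D_infinity_def)
  then have k: "x \<in> D G F \<Sigma> k" "\<And>j. j < k \<Longrightarrow> x \<notin> D G F \<Sigma> j"
    unfolding k_def by (auto intro: LeastI_ex dest: not_less_Least)
  have "n < k" using k(1) x(2) D_mono by (meson in_mono not_le_imp_less)
  then have "x \<in> boundary_D G F \<Sigma> (Suc n + (k - Suc n))"
    using k by (simp add: boundary_D_def)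
  then show ?thesis using boundary_pow invariant_pow \<Gamma>(1) x(1) by blast
qed

text \<open>This is the step from 3 to 1: an element of \<open>\<Gamma>\<close> in a boundary
  \<open>m\<close> levels higher brings its whole span into \<open>\<Gamma>\<close>, and with it the
  chosen \<open>D\<close>.\<close>

lemma infinite_invariant_eq_D_infinity:
  assumes m: "\<And>n d. d \<in> boundary_D G F \<Sigma> (Suc n + m) \<Longrightarrow> D G F \<Sigma> (Suc n) \<subseteq> invariant_span G F d"
    and \<Gamma>: "invariant_subgroup G F \<Gamma>" "infinite \<Gamma>" "\<Gamma> \<subseteq> D_infinity G F \<Sigma>"
  shows "\<Gamma> = D_infinity G F \<Sigma>"
proof -
  have "D G F \<Sigma> n \<subseteq> \<Gamma>" for n
  proof -
    obtain d where "d \<in> \<Gamma>" "d \<in> boundary_D G F \<Sigma> (Suc n + m)"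
      using infinite_invariant_meets_boundary[OF \<Gamma>, of "n + m"] by auto
    then have "D G F \<Sigma> (Suc n) \<subseteq> \<Gamma>"
      using m invariant_span_least[OF \<Gamma>(1)] by blast
    then show ?thesis using D_mono[of n "Suc n"] by auto
  qed
  then show ?thesis using \<Gamma>(3) by (auto simp: D_infinity_def)
qed

text \<open>Monotonicity puts any two elements of the union into a common member, where they can be
  multiplied.\<close>

lemma invariant_subgroup_chain_Union:
  assumes inv: "\<And>n. invariant_subgroup G F (\<Gamma> n)" and mono: "incseq \<Gamma>"
  shows "invariant_subgroup G F (\<Union>n. \<Gamma> n)"
proof -
  have sub: "\<And>n. subgroup (\<Gamma> n) G" using inv by (simp add: invariant_subgroup_def)
  have "subgroup (\<Union>n. \<Gamma> n) G"
  proof (rule subgroupI)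
    show "(\<Union>n. \<Gamma> n) \<noteq> {}" using subgroup.one_closed[OF sub] by blast
  next
    fix a assume "a \<in> (\<Union>n. \<Gamma> n)"
    then show "inv a \<in> (\<Union>n. \<Gamma> n)" using subgroup.m_inv_closed[OF sub] by blast
  next
    fix a b assume "a \<in> (\<Union>n. \<Gamma> n)" "b \<in> (\<Union>n. \<Gamma> n)"
    then obtain i j where "a \<in> \<Gamma> i" "b \<in> \<Gamma> j" by blast
    then have "a \<in> \<Gamma> (max i j)" "b \<in> \<Gamma> (max i j)"
      using incseqD[OF mono] by (meson max.cobounded1 max.cobounded2 in_mono)+
    then show "a \<otimes> b \<in> (\<Union>n. \<Gamma> n)" using subgroup.m_closed[OF sub] by blast
  qed simp
  then show ?thesis
    using inv unfolding invariant_subgroup_def image_UN by blast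
qed

text \<open>The step from 1 to 4, by contradiction: counterexamples at all levels are threaded into
  one increasing chain of spans.\<close>

lemma ex_boundary_D_subset_span:
  assumes simple: "\<And>\<Gamma>. \<lbrakk>invariant_subgroup G F \<Gamma>; infinite \<Gamma>; \<Gamma> \<subseteq> D_infinity G F \<Sigma>\<rbrakk>
    \<Longrightarrow> \<Gamma> = D_infinity G F \<Sigma>"
  shows "\<exists>m. \<forall>d\<in>boundary_D G F \<Sigma> (Suc m). D G F \<Sigma> 1 \<subseteq> invariant_span G F d"
proof (rule ccontr)
  assume contra: "\<not> ?thesis"
  define E where "E n = {d \<in> boundary_D G F \<Sigma> (Suc n). \<not> D G F \<Sigma> 1 \<subseteq> invariant_span G F d}" for n
  \<comment> \<open>Spans shrink under \<open>F\<close>, so \<open>F\<close> maps counterexamples to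
    counterexamples; along the thread the same inclusion makes the spans increase.\<close>
  have span_F: "invariant_span G F (F x) \<subseteq> invariant_span G F x" for x
    using invariant_pow[OF invariant_span_invariant mem_invariant_span, of 1]
    by (intro invariant_span_least invariant_span_invariant) auto
  have "E n \<noteq> {}" for n using contra unfolding E_def by blast
  moreover have "finite (E n)" for n
    by (rule finite_subset[OF _ finite_D[of "Suc n"]]) (auto simp: E_def boundary_D_def)
  moreover have "F x \<in> E n" if "x \<in> E (Suc n)" for n x
    using that span_F[of x] boundary_pow[of x n 1] by (auto simp: E_def)
  ultimately obtain d where d: "\<And>n. d n \<in> E n" "\<And>n. F (d (Suc n)) = d n"
    using inverse_limit_nonempty[of E F] by blast
  let ?S = "\<lambda>n. invariant_span G F (d n)"
  have mono: "incseq ?S" using span_F[of "d (Suc _)"] d(2) by (intro incseq_SucI) simp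
  have bd: "d n \<in> D G F \<Sigma> (Suc n)" "d n \<notin> D G F \<Sigma> n" for n
    using d(1)[of n] by (auto simp: E_def boundary_D_def)
  \<comment> \<open>The points \<open>d n\<close> have pairwise different exact levels, which makes
    the union of the spans infinite.\<close>
  have "inj d"
  proof (rule linorder_injI)
    fix i j :: nat assume "i < j"
    then show "d i \<noteq> d j" using bd(1)[of i] bd(2)[of j] D_mono[of "Suc i" j] by auto
  qed
  then have "infinite (range d)" using finite_imageD by blast
  moreover have "range d \<subseteq> (\<Union>n. ?S n)" using mem_invariant_span by blast
  ultimately have "infinite (\<Union>n. ?S n)" using finite_subset by blast
  moreover have "(\<Union>n. ?S n) \<subseteq> D_infinity G F \<Sigma>"
    using invariant_span_least[OF invariant_D bd(1)] by (fastforce simp: D_infinity_def)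
  ultimately have "(\<Union>n. ?S n) = D_infinity G F \<Sigma>"
    using simple invariant_subgroup_chain_Union[OF invariant_span_invariant mono] by blast
  then have "D G F \<Sigma> 1 \<subseteq> (\<Union>n. ?S n)" by (auto simp: D_infinity_def)
  moreover have "subset.chain UNIV (range ?S)"
    unfolding subset_chain_def
  proof (intro conjI ballI subset_UNIV)
    fix A B assume "A \<in> range ?S" "B \<in> range ?S"
    then obtain i j where ij: "A = ?S i" "B = ?S j" by blast
    show "A \<subseteq> B \<or> B \<subseteq> A"
      unfolding ij using incseqD[OF mono, of i j] incseqD[OF mono, of j i] nat_le_linear by blast
  qed
  \<comment> \<open>A finite set covered by the union of a chain lies in a single member; here this
    contradicts the choice of \<open>d n\<close>.\<close>
  ultimately obtain n where "D G F \<Sigma> 1 \<subseteq> ?S n"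
    using finite_subset_Union_chain[OF finite_D, of 1 "range ?S"] by blast
  then show False using d(1)[of n] by (simp add: E_def)
qed

end

section \<open>Equivalence of the four statements\<close>

theorem proposition4p6:
  fixes G :: "(int \<Rightarrow> 'a :: finite) monoid"
    and F :: "(int \<Rightarrow> 'a) \<Rightarrow> (int \<Rightarrow> 'a)"
    and \<Sigma> :: "(int \<Rightarrow> 'a) set"
  assumes "abelian_group_shift G"
    and "algebraic_CA G F"
    and "bipermutative F"
    and "closedin config_topology \<Sigma>"
    and "invariant_subgroup G F \<Sigma>"
  shows "let
      S1 = (\<forall>\<Gamma>. invariant_subgroup G F \<Gamma> \<and> infinite \<Gamma> \<and> \<Gamma> \<subseteq> D_infinity G F \<Sigma>
              \<longrightarrow> \<Gamma> = D_infinity G F \<Sigma>);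
      S2 = (\<exists>m n\<^sub>0. n\<^sub>0 \<ge> 1 \<and>
              (\<forall>d \<in> boundary_D G F \<Sigma> (n\<^sub>0 + m). D G F \<Sigma> n\<^sub>0 \<subseteq> invariant_span G F d));
      S3 = (\<exists>m. \<forall>n\<^sub>0 \<ge> 1.
              \<forall>d \<in> boundary_D G F \<Sigma> (n\<^sub>0 + m). D G F \<Sigma> n\<^sub>0 \<subseteq> invariant_span G F d);
      S4 = (\<exists>m. \<forall>d \<in> boundary_D G F \<Sigma> (m + 1). D G F \<Sigma> 1 \<subseteq> invariant_span G F d)
    in (S1 \<longleftrightarrow> S2) \<and> (S2 \<longleftrightarrow> S3) \<and> (S3 \<longleftrightarrow> S4)"
proof -
  interpret G: comm_group G using assms(1) by (simp add: abelian_group_shift_def)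
  interpret algebraic_ca G F \<Sigma>
  proof
    show "F (shift x) = shift (F x)" for x
      using assms(2) by (simp add: algebraic_CA_def cellular_automaton_def comp_def fun_eq_iff)
  qed (use assms bipermutative_finite_fibre in
      \<open>auto simp: abelian_group_shift_def algebraic_CA_def\<close>)
  let ?B = "boundary_D G F \<Sigma>" and ?D = "D G F \<Sigma>" and ?S = "invariant_span G F"
  define S1 where "S1 \<longleftrightarrow> (\<forall>\<Gamma>. invariant_subgroup G F \<Gamma> \<and> infinite \<Gamma> \<and> \<Gamma> \<subseteq> D_infinity G F \<Sigma>
      \<longrightarrow> \<Gamma> = D_infinity G F \<Sigma>)"
  define S2 where "S2 \<longleftrightarrow> (\<exists>m n0. n0 \<ge> 1 \<and> (\<forall>d \<in> ?B (n0 + m). ?D n0 \<subseteq> ?S d))"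
  define S3 where "S3 \<longleftrightarrow> (\<exists>m. \<forall>n0 \<ge> 1. \<forall>d \<in> ?B (n0 + m). ?D n0 \<subseteq> ?S d)"
  define S4 where "S4 \<longleftrightarrow> (\<exists>m. \<forall>d \<in> ?B (m + 1). ?D 1 \<subseteq> ?S d)"
  \<comment> \<open>The implications form the cycle \<open>S1\<close>, \<open>S4\<close>,
    \<open>S3\<close>, \<open>S1\<close>, and \<open>S2\<close> is inserted between
    \<open>S3\<close> and \<open>S4\<close>.\<close>
  have "S4" if S1
    using ex_boundary_D_subset_span that by (simp add: S1_def S4_def)
  moreover have "S3" if S4
  proof -
    from that obtain m where m: "\<And>d. d \<in> ?B (Suc m) \<Longrightarrow> ?D 1 \<subseteq> ?S d"
      by (auto simp: S4_def)
    have "?D n0 \<subseteq> ?S d" if "n0 \<ge> 1" "d \<in> ?B (n0 + m)" for n0 d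
      using D_subset_span_lift[OF m, where n = "n0 - 1"] that by simp
    then show ?thesis by (auto simp: S3_def)
  qed
  moreover have "S1" if S3
  proof -
    from that obtain m where m: "\<And>n0 d. n0 \<ge> 1 \<Longrightarrow> d \<in> ?B (n0 + m) \<Longrightarrow> ?D n0 \<subseteq> ?S d"
      by (auto simp: S3_def)
    have "?D (Suc n) \<subseteq> ?S d" if "d \<in> ?B (Suc n + m)" for n d
      using m[of "Suc n" d] that by simp
    then show ?thesis
      unfolding S1_def using infinite_invariant_eq_D_infinity by blast
  qed
  moreover have "S2" if S3 using that unfolding S2_def S3_def by blast
  moreover have "S4" if S2
  proof -
    from that obtain m n0 where n0: "n0 \<ge> 1" and sub: "\<forall>d \<in> ?B (n0 + m). ?D n0 \<subseteq> ?S d"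
      by (auto simp: S2_def)
    \<comment> \<open>The witness for \<open>S4\<close> is \<open>n0 + m - 1\<close>: as
      \<open>n0 \<ge> 1\<close>, the boundary is the one at \<open>n0 + m\<close>, and
      \<open>?D 1\<close> lies in \<open>?D n0\<close>.\<close>
    have "\<forall>d \<in> ?B (n0 + m - 1 + 1). ?D 1 \<subseteq> ?S d"
      using n0 sub D_mono[OF n0] by fastforce
    then show ?thesis unfolding S4_def by blast
  qed
  ultimately show ?thesis
    unfolding Let_def S1_def[symmetric] S2_def[symmetric] S3_def[symmetric] S4_def[symmetric]
    by blast
qed

end
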